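(* Let $G$ be a graph with maximum degree $\Delta(G)$ and chromatic polynomial $\chi_G$. If $\chi_G(z)=0$ for some $z\in\mathbb{C}$, then $|z|\leq 4.25\,\Delta(G)$.
   Context: Graphs are finite and simple. The chromatic polynomial $\chi_G(x)$ of an $n$-vertex graph $G$ is the unique monic polynomial of degree $n$ such that for every positive integer $q$, $\chi_G(q)$ equals the number of proper $q$-colorings of $G$. *)

theory Defs
  imports Complex_Main "HOL-Library.FuncSet" "HOL-Computational_Algebra.Polynomial"
begin

definition simple_graph :: "'a set \<Rightarrow> 'a set set \<Rightarrow> bool" where
  "simple_graph V E \<longleftrightarrow> finite V \<and> E \<subseteq> {e. e \<subseteq> V \<and> card e = 2}"

definition vertex_degree :: "'a set set \<Rightarrow> 'a \<Rightarrow> nat" where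
  "vertex_degree E v = card {e \<in> E. v \<in> e}"

(* The graph without vertices gets maximum degree 0. *)
definition max_degree :: "'a set \<Rightarrow> 'a set set \<Rightarrow> nat" where
  "max_degree V E = (if V = {} then 0 else Max (vertex_degree E ` V))"

(* The extensional function space counts each map from V to {..<q} exactly once. *)
definition proper_colorings :: "'a set \<Rightarrow> 'a set set \<Rightarrow> nat \<Rightarrow> ('a \<Rightarrow> nat) set" where
  "proper_colorings V E q =
     {f \<in> V \<rightarrow>\<^sub>E {..<q}. \<forall>u v. {u, v} \<in> E \<longrightarrow> f u \<noteq> f v}"

definition is_chromatic_poly :: "'a set \<Rightarrow> 'a set set \<Rightarrow> complex poly \<Rightarrow> bool" where
  "is_chromatic_poly V E p \<longleftrightarrow>
     lead_coeff p = 1 \<and> degree p = card V \<and>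
     (\<forall>q::nat. q > 0 \<longrightarrow> poly p (of_nat q) = of_nat (card (proper_colorings V E q)))"

definition chromatic_poly :: "'a set \<Rightarrow> 'a set set \<Rightarrow> complex poly" where
  "chromatic_poly V E = (THE p. is_chromatic_poly V E p)"

lemma is_chromatic_poly_unique:
  assumes "is_chromatic_poly V E p" "is_chromatic_poly V E r"
  shows "p = r"
proof (rule ccontr)
  assume "p \<noteq> r"
  hence "finite {x. poly (p - r) x = 0}" by (intro poly_roots_finite) simp
  moreover have "(of_nat :: nat \<Rightarrow> complex) ` {0<..} \<subseteq> {x. poly (p - r) x = 0}"
    using assms by (auto simp: is_chromatic_poly_def)
  ultimately have "finite ((of_nat :: nat \<Rightarrow> complex) ` {0<..})"
    by (rule rev_finite_subset)
  moreover have "inj_on (of_nat :: nat \<Rightarrow> complex) {0<..}" by (simp add: inj_on_def)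
  ultimately have "finite {0::nat<..}" by (simp add: finite_image_iff)
  thus False by (simp add: infinite_Ioi)
qed

(* A proper coloring is a proper coloring onto its image, so with s k the number of proper
   colorings onto {..<k}, there are (SUM k <= card V. s k * (q choose k)) proper
   q-colorings; moreover s (card V) = fact (card V). *)

definition onto_colorings :: "'a set \<Rightarrow> 'a set set \<Rightarrow> 'b set \<Rightarrow> ('a \<Rightarrow> 'b) set" where
  "onto_colorings V E C =
     {f \<in> V \<rightarrow>\<^sub>E C. f ` V = C \<and> (\<forall>u v. {u, v} \<in> E \<longrightarrow> f u \<noteq> f v)}"

lemma card_onto_colorings:
  assumes G: "simple_graph V E" and C: "finite C"
  shows "card (onto_colorings V E C) = card (onto_colorings V E {..<card C})"
proof -
  obtain h where h: "bij_betw h C {..<card C}"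
    using ex_bij_betw_finite_nat[OF C] by (auto simp: atLeast0LessThan)
  let ?h' = "inv_into C h"
  have h': "bij_betw ?h' {..<card C} C" using h by (rule bij_betw_inv_into)
  have EV: "u \<in> V" "v \<in> V" if "{u, v} \<in> E" for u v
    using G that by (auto simp: simple_graph_def)
  have tr: "(\<lambda>x\<in>V. g (f x)) \<in> onto_colorings V E B"
    if f: "f \<in> onto_colorings V E A" and g: "bij_betw g A B"
    for f :: "'a \<Rightarrow> 'c" and g :: "'c \<Rightarrow> 'd" and A B
  proof -
    have fV: "f ` V = A" using f by (simp add: onto_colorings_def)
    have "g (f u) \<noteq> g (f v)" if "{u, v} \<in> E" for u v
    proof -
      have "f u \<noteq> f v" using f that by (auto simp: onto_colorings_def)
      moreover have "f u \<in> A" "f v \<in> A" using EV[OF that] fV by auto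
      ultimately show ?thesis using g by (metis bij_betw_def inj_on_def)
    qed
    moreover have "(\<lambda>x. g (f x)) ` V = B"
      using fV g by (metis bij_betw_def image_image)
    ultimately show ?thesis
      using EV by (auto simp: onto_colorings_def)
  qed
  have "bij_betw (\<lambda>f. \<lambda>x\<in>V. h (f x)) (onto_colorings V E C) (onto_colorings V E {..<card C})"
  proof (rule bij_betw_byWitness[where f' = "\<lambda>f. \<lambda>x\<in>V. ?h' (f x)"])
    show "\<forall>f\<in>onto_colorings V E C. (\<lambda>x\<in>V. ?h' ((\<lambda>x\<in>V. h (f x)) x)) = f"
      using h by (auto simp: onto_colorings_def fun_eq_iff PiE_def extensional_def
          bij_betw_inv_into_left Pi_def)
    show "\<forall>f\<in>onto_colorings V E {..<card C}. (\<lambda>x\<in>V. h ((\<lambda>x\<in>V. ?h' (f x)) x)) = f"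
      using h by (auto simp: onto_colorings_def fun_eq_iff PiE_def extensional_def
          bij_betw_inv_into_right Pi_def)
  qed (use tr h h' in blast)+
  thus ?thesis by (rule bij_betw_same_card)
qed

lemma card_proper_colorings:
  assumes G: "simple_graph V E"
  shows "card (proper_colorings V E q) =
           (\<Sum>k\<le>card V. card (onto_colorings V E {..<k}) * (q choose k))"
proof -
  have finV: "finite V" using G by (simp add: simple_graph_def)
  let ?Cs = "{C. C \<subseteq> {..<q} \<and> card C \<le> card V}"
  have finCs: "finite ?Cs" by simp
  have fin: "finite (onto_colorings V E C)" if "C \<subseteq> {..<q}" for C
    using finV that
    by (auto simp: onto_colorings_def intro!: finite_PiE finite_subset[OF that])
  have U: "proper_colorings V E q = (\<Union>C\<in>?Cs. onto_colorings V E C)"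
  proof safe
    fix f assume f: "f \<in> proper_colorings V E q"
    have "f ` V \<in> ?Cs" using f finV
      by (auto simp: proper_colorings_def card_image_le)
    moreover have "f \<in> onto_colorings V E (f ` V)"
      using f by (auto simp: proper_colorings_def onto_colorings_def PiE_def)
    ultimately show "f \<in> (\<Union>C\<in>?Cs. onto_colorings V E C)" by blast
  next
    fix f C assume "C \<subseteq> {..<q}" "f \<in> onto_colorings V E C"
    thus "f \<in> proper_colorings V E q"
      by (auto simp: proper_colorings_def onto_colorings_def PiE_def Pi_def)
  qed
  have "card (proper_colorings V E q) = (\<Sum>C\<in>?Cs. card (onto_colorings V E C))"
    unfolding U
  proof (rule card_UN_disjoint[OF finCs])
    show "\<forall>C\<in>?Cs. finite (onto_colorings V E C)" using fin by blast
    show "\<forall>C\<in>?Cs. \<forall>D\<in>?Cs. C \<noteq> D \<longrightarrow> onto_colorings V E C \<inter> onto_colorings V E D = {}"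
      by (auto simp: onto_colorings_def)
  qed
  also have "\<dots> = (\<Sum>C\<in>?Cs. card (onto_colorings V E {..<card C}))"
    by (intro sum.cong refl card_onto_colorings[OF G]) (auto intro: finite_subset)
  also have "\<dots> = (\<Sum>k\<le>card V. \<Sum>C\<in>{C\<in>?Cs. card C = k}. card (onto_colorings V E {..<card C}))"
    by (rule sum.group[symmetric]) auto
  also have "\<dots> = (\<Sum>k\<le>card V. card (onto_colorings V E {..<k}) * (q choose k))"
  proof (rule sum.cong[OF refl])
    fix k assume "k \<in> {..card V}"
    hence *: "{C\<in>?Cs. card C = k} = {C. C \<subseteq> {..<q} \<and> card C = k}" by auto
    show "(\<Sum>C\<in>{C\<in>?Cs. card C = k}. card (onto_colorings V E {..<card C}))
        = card (onto_colorings V E {..<k}) * (q choose k)"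
      unfolding * using n_subsets[of "{..<q}" k] by simp
  qed
  finally show ?thesis .
qed

lemma card_onto_colorings_top:
  assumes G: "simple_graph V E"
  shows "card (onto_colorings V E {..<card V}) = fact (card V)"
proof -
  have finV: "finite V" using G by (simp add: simple_graph_def)
  have "onto_colorings V E {..<card V} = {f \<in> V \<rightarrow>\<^sub>E {..<card V}. inj_on f V}"
  proof (intro equalityI subsetI)
    fix f assume f: "f \<in> onto_colorings V E {..<card V}"
    hence "card (f ` V) = card V" by (simp add: onto_colorings_def)
    with finV have "inj_on f V" by (rule eq_card_imp_inj_on)
    with f show "f \<in> {f \<in> V \<rightarrow>\<^sub>E {..<card V}. inj_on f V}"
      by (simp add: onto_colorings_def)
  next
    fix f assume "f \<in> {f \<in> V \<rightarrow>\<^sub>E {..<card V}. inj_on f V}"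
    hence f: "f \<in> V \<rightarrow>\<^sub>E {..<card V}" and i: "inj_on f V" by auto
    have "f ` V = {..<card V}"
      using f i by (intro card_subset_eq) (auto simp: card_image)
    moreover have "f u \<noteq> f v" if "{u, v} \<in> E" for u v
    proof -
      have "u \<in> V" "v \<in> V" "card {u, v} = 2" using G that by (auto simp: simple_graph_def)
      thus ?thesis using i by (auto simp: inj_on_def card_insert_if split: if_splits)
    qed
    ultimately show "f \<in> onto_colorings V E {..<card V}"
      using f by (auto simp: onto_colorings_def)
  qed
  thus ?thesis
    using card_inj_on_subset_funcset[OF finV, of "{..<card V}" V]
    by (simp add: fact_prod_rev atLeast0LessThan)
qed

lemma is_chromatic_poly_chromatic_poly:
  assumes G: "simple_graph V E"
  shows "is_chromatic_poly V E (chromatic_poly V E)"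
proof -
  define n where "n = card V"
  define ff :: "nat \<Rightarrow> complex poly" where "ff k = (\<Prod>i<k. [:- of_nat i, 1:])" for k
  define c :: "nat \<Rightarrow> complex"
    where "c k = of_nat (card (onto_colorings V E {..<k})) / fact k" for k
  define p where "p = (\<Sum>k\<le>n. smult (c k) (ff k))"
  have ff: "degree (ff k) = k \<and> lead_coeff (ff k) = 1" for k
  proof -
    have "degree (ff k) = (\<Sum>i<k. 1)"
      unfolding ff_def by (subst degree_prod_eq_sum_degree) auto
    moreover have "lead_coeff (ff k) = 1"
      unfolding ff_def by (simp add: lead_coeff_prod)
    ultimately show ?thesis by simp
  qed
  have cn: "c n = 1"
    using card_onto_colorings_top[OF G] by (simp add: c_def n_def)
  have low: "coeff (smult (c k) (ff k)) m = 0" if "k < m" for k m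
    using ff[of k] that by (simp add: coeff_eq_0)
  have "coeff p n = (\<Sum>k\<le>n. coeff (smult (c k) (ff k)) n)"
    by (simp add: p_def coeff_sum)
  also have "\<dots> = (\<Sum>k\<in>{n}. coeff (smult (c k) (ff k)) n)"
    by (rule sum.mono_neutral_right) (use low in auto)
  also have "\<dots> = 1" using ff[of n] cn by auto
  finally have 1: "coeff p n = 1" .
  have "degree p \<le> n"
    unfolding p_def by (rule degree_sum_le) (use ff in \<open>auto intro: order_trans[OF degree_smult_le]\<close>)
  with 1 have deg: "degree p = n" using le_degree[of p n] by simp
  have ev: "poly p (of_nat q) = of_nat (card (proper_colorings V E q))" for q :: nat
  proof -
    have "poly (smult (c k) (ff k)) (of_nat q)
        = of_nat (card (onto_colorings V E {..<k}) * (q choose k))" for k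
    proof -
      have "poly (ff k) (of_nat q) = (\<Prod>i<k. of_nat q - of_nat i)"
        by (simp add: ff_def poly_prod)
      also have "\<dots> = fact k * (of_nat q gchoose k)"
        by (simp add: gbinomial_prod_rev atLeast0LessThan)
      finally show ?thesis by (simp add: c_def binomial_gbinomial)
    qed
    thus ?thesis
      by (simp add: p_def poly_sum card_proper_colorings[OF G] n_def del: poly_smult)
  qed
  have "is_chromatic_poly V E p"
    using 1 deg ev by (simp add: is_chromatic_poly_def n_def)
  thus ?thesis
    unfolding chromatic_poly_def by (rule theI) (rule is_chromatic_poly_unique[OF _ \<open>is_chromatic_poly V E p\<close>])
qed

end

theory Submission
  imports Defs
begin

text \<open>Write \<open>f(G) = \<chi>\<^sub>G(z) / z\<^sup>n\<close> and \<open>x = -1/z\<close>, so that deletion-contraction reads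
  \<open>f(G + vw) = f(G) + x f((G + vw)/vw)\<close>. For an induced subgraph \<open>H\<close> of the given graph, a vertex
  \<open>v\<close> of \<open>H\<close> and \<open>b\<close> vertices \<open>S\<close> not adjacent to \<open>v\<close>, let \<open>Q = f(H + vS)/f(H)\<close> be the effect of
  joining \<open>v\<close> to \<open>S\<close>; then \<open>Q\<close> is close to \<open>1 + xb\<close>. Indeed, adding one more edge \<open>vw\<close> changes \<open>Q\<close>
  by \<open>x Q'/R\<close>, where \<open>Q'\<close> is the effect of joining \<open>v\<close> to \<open>S\<close> and \<open>N(w)\<close> in \<open>H - w\<close>, and
  \<open>R = f(H)/f(H - w)\<close> arises from \<open>1\<close> by adding the edges at \<open>w\<close> one at a time, each of which
  contributes \<open>x\<close> times the effect of a star in \<open>H - w\<close>. The linear terms of \<open>Q'\<close> and \<open>R\<close> cancel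
  to a large extent, so \<open>Q'/R\<close> is close to \<open>1\<close>. Induction on the size of \<open>H\<close> keeps the errors below
  an explicit exponential majorant if \<open>\<bar>z\<bar> \<ge> 4.25 \<Delta>\<close>, and in particular keeps \<open>f(H)\<close>
  away from \<open>0\<close>.\<close>

section \<open>Deletion and contraction for chromatic polynomials\<close>

text \<open>Infinitely many common values determine a polynomial, so every identity below reduces to
  counting colorings.\<close>

lemma chromatic_poly_eqI:
  assumes "simple_graph V E"
    and "\<And>q. q > 0 \<Longrightarrow> poly p (of_nat q) = of_nat (card (proper_colorings V E q))"
  shows "chromatic_poly V E = p"
proof (rule ccontr)
  assume "chromatic_poly V E \<noteq> p"
  hence "finite {x. poly (chromatic_poly V E - p) x = 0}" by (intro poly_roots_finite) simp
  moreover have "(of_nat :: nat \<Rightarrow> complex) ` {0<..} \<subseteq> {x. poly (chromatic_poly V E - p) x = 0}"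
    using assms(2) is_chromatic_poly_chromatic_poly[OF assms(1)]
    by (auto simp: is_chromatic_poly_def)
  ultimately have "finite ((of_nat :: nat \<Rightarrow> complex) ` {0<..})"
    by (rule rev_finite_subset)
  moreover have "inj_on (of_nat :: nat \<Rightarrow> complex) {0<..}" by (simp add: inj_on_def)
  ultimately have "finite {0::nat<..}" by (simp add: finite_image_iff)
  thus False by (simp add: infinite_Ioi)
qed

lemma poly_chromatic_poly_of_nat:
  assumes "simple_graph V E" "q > 0"
  shows "poly (chromatic_poly V E) (of_nat q) = of_nat (card (proper_colorings V E q))"
  using is_chromatic_poly_chromatic_poly[OF assms(1)] assms(2) by (simp add: is_chromatic_poly_def)

lemma simple_graph_edgeD:
  assumes "simple_graph V E" "{u, v} \<in> E"
  shows "u \<in> V" "v \<in> V" "u \<noteq> v"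
proof -
  have "{u, v} \<subseteq> V" "card {u, v} = 2" using assms unfolding simple_graph_def by blast+
  then show "u \<in> V" "v \<in> V" "u \<noteq> v" by auto
qed

lemma finite_proper_colorings: "finite V \<Longrightarrow> finite (proper_colorings V E q)"
  by (auto simp: proper_colorings_def intro!: finite_PiE)

lemma chromatic_poly_empty: "chromatic_poly {} {} = 1"
  by (rule chromatic_poly_eqI) (auto simp: simple_graph_def proper_colorings_def)

text \<open>The color of \<open>w\<close> is free, which gives a factor q; \<open>pCons 0\<close> is
  multiplication by the variable.\<close>

lemma chromatic_poly_isolated:
  assumes G: "simple_graph V E" and w: "w \<notin> V"
  shows "chromatic_poly (insert w V) E = pCons 0 (chromatic_poly V E)"
proof (rule chromatic_poly_eqI)
  show "simple_graph (insert w V) E" using G by (auto simp: simple_graph_def)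
  fix q :: nat assume q: "q > 0"
  have E: "u \<noteq> w \<and> v \<noteq> w" if "{u, v} \<in> E" for u v
    using simple_graph_edgeD[OF G that] w by auto
  have "bij_betw (\<lambda>(c, f). f(w := c)) ({..<q} \<times> proper_colorings V E q)
      (proper_colorings (insert w V) E q)"
  proof (rule bij_betw_byWitness[where f' = "\<lambda>f. (f w, f(w := undefined))"])
    show "(\<lambda>(c, f). f(w := c)) ` ({..<q} \<times> proper_colorings V E q)
        \<subseteq> proper_colorings (insert w V) E q"
      using E by (auto simp: proper_colorings_def PiE_def extensional_def)
    show "(\<lambda>f. (f w, f(w := undefined))) ` proper_colorings (insert w V) E q
        \<subseteq> {..<q} \<times> proper_colorings V E q"
      using E w by (auto simp: proper_colorings_def PiE_def extensional_def)
  qed (use w in \<open>auto simp: proper_colorings_def PiE_def extensional_def fun_eq_iff\<close>)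
  from bij_betw_same_card[OF this]
  have "card (proper_colorings (insert w V) E q) = q * card (proper_colorings V E q)"
    by (simp add: card_cartesian_product)
  then show "poly (pCons 0 (chromatic_poly V E)) (of_nat q)
      = of_nat (card (proper_colorings (insert w V) E q))"
    by (simp add: poly_chromatic_poly_of_nat[OF G q])
qed

definition star :: "'a \<Rightarrow> 'a set \<Rightarrow> 'a set set" where
  "star v S = (\<lambda>u. {v, u}) ` S"

definition nbhd :: "'a set set \<Rightarrow> 'a \<Rightarrow> 'a set" where
  "nbhd E v = {u. {v, u} \<in> E}"

lemma star_empty [simp]: "star v {} = {}"
  and star_insert [simp]: "star v (insert u S) = insert {v, u} (star v S)"
  and star_Un: "star v (S \<union> T) = star v S \<union> star v T"
  by (auto simp: star_def)

lemma simple_graph_Un_star: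
  assumes "simple_graph V E" "v \<in> V" "S \<subseteq> V - {v}"
  shows "simple_graph V (E \<union> star v S)"
  using assms by (auto simp: simple_graph_def star_def card_insert_if)

text \<open>Contracting the non-edge \<open>vw\<close> amounts to deleting \<open>w\<close> and joining \<open>v\<close> to
  the neighbours of \<open>w\<close>.\<close>

lemma chromatic_poly_insert_edge:
  assumes G: "simple_graph V E" and vw: "v \<in> V" "w \<in> V" "v \<noteq> w" "{v, w} \<notin> E"
  shows "chromatic_poly V (insert {v, w} E)
    = chromatic_poly V E - chromatic_poly (V - {w}) ({e \<in> E. w \<notin> e} \<union> star v (nbhd E w))"
proof (rule chromatic_poly_eqI)
  let ?C = "{e \<in> E. w \<notin> e} \<union> star v (nbhd E w)"
  show "simple_graph V (insert {v, w} E)"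
    using G vw by (auto simp: simple_graph_def)
  have nb: "nbhd E w \<subseteq> V - {v} - {w}"
    using simple_graph_edgeD[OF G] vw by (auto simp: nbhd_def insert_commute)
  have G': "simple_graph (V - {w}) ?C"
    by (rule simple_graph_Un_star) (use G vw nb in \<open>auto simp: simple_graph_def\<close>)
  have fin: "finite V" using G by (simp add: simple_graph_def)
  fix q :: nat assume q: "q > 0"
  let ?X = "{f \<in> proper_colorings V E q. f v = f w}"
  have 1: "proper_colorings V E q = proper_colorings V (insert {v, w} E) q \<union> ?X"
    by (auto simp: proper_colorings_def doubleton_eq_iff)
  have 2: "proper_colorings V (insert {v, w} E) q \<inter> ?X = {}"
    by (auto simp: proper_colorings_def)
  \<comment> \<open>A coloring with equal colors at \<open>v\<close> and \<open>w\<close> is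
    recovered from its restriction to \<open>V - {w}\<close> by copying the color of
    \<open>v\<close>; extensionality forces the value \<open>undefined\<close> at
    \<open>w\<close>.\<close>
  have 3: "bij_betw (\<lambda>f. f(w := undefined)) ?X (proper_colorings (V - {w}) ?C q)"
  proof (rule bij_betw_byWitness[where f' = "\<lambda>f. f(w := f v)"])
    show "\<forall>f\<in>?X. (f(w := undefined))(w := (f(w := undefined)) v) = f"
      using vw by (auto simp: fun_eq_iff)
    show "\<forall>f\<in>proper_colorings (V - {w}) ?C q. (f(w := f v))(w := undefined) = f"
      by (auto simp: fun_eq_iff proper_colorings_def PiE_def extensional_def)
    show "(\<lambda>f. f(w := undefined)) ` ?X \<subseteq> proper_colorings (V - {w}) ?C q"
    proof safe
      fix f assume f: "f \<in> proper_colorings V E q" and fv: "f v = f w"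
      have pr: "f a \<noteq> f b" if "{a, b} \<in> E" for a b
        using f that by (auto simp: proper_colorings_def)
      have "(f(w := undefined)) a \<noteq> (f(w := undefined)) b" if ab: "{a, b} \<in> ?C" for a b
      proof (cases "{a, b} \<in> {e \<in> E. w \<notin> e}")
        case True
        then show ?thesis using pr by auto
      next
        case False
        then obtain u where u: "u \<in> nbhd E w" "{a, b} = {v, u}"
          using ab by (auto simp: star_def)
        then have "f w \<noteq> f u" using pr by (simp add: nbhd_def)
        then show ?thesis using u nb vw fv by (auto simp: doubleton_eq_iff)
      qed
      then show "f(w := undefined) \<in> proper_colorings (V - {w}) ?C q"
        using f by (auto simp: proper_colorings_def PiE_def extensional_def)
    qed
    show "(\<lambda>f. f(w := f v)) ` proper_colorings (V - {w}) ?C q \<subseteq> ?X"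
    proof safe
      fix f assume f: "f \<in> proper_colorings (V - {w}) ?C q"
      have pr: "f a \<noteq> f b" if "{a, b} \<in> ?C" for a b
        using f that unfolding proper_colorings_def by blast
      have prw: "f v \<noteq> f b" if "{w, b} \<in> E" for b
        using pr[of v b] that by (auto simp: star_def nbhd_def)
      have "(f(w := f v)) a \<noteq> (f(w := f v)) b" if ab: "{a, b} \<in> E" for a b
      proof -
        have "a \<noteq> b" using simple_graph_edgeD[OF G ab] by simp
        consider "a = w" | "b = w" | "a \<noteq> w" "b \<noteq> w" by blast
        then show ?thesis
        proof cases
          case 1 then show ?thesis using prw[of b] ab \<open>a \<noteq> b\<close> by simp
        next
          case 2 then show ?thesis using prw[of a] ab \<open>a \<noteq> b\<close> by (auto simp: insert_commute)
        next
          case 3 then show ?thesis using pr[of a b] ab by auto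
        qed
      qed
      moreover have "f(w := f v) \<in> V \<rightarrow>\<^sub>E {..<q}"
        using f vw by (auto simp: proper_colorings_def PiE_def extensional_def)
      ultimately show "f(w := f v) \<in> proper_colorings V E q"
        unfolding proper_colorings_def by blast
      show "(f(w := f v)) v = (f(w := f v)) w" using vw by simp
    qed
  qed
  have "card (proper_colorings V E q) = card (proper_colorings V (insert {v, w} E) q)
      + card (proper_colorings (V - {w}) ?C q)"
    unfolding bij_betw_same_card[OF 3, symmetric]
    by (subst 1, rule card_Un_disjoint)
      (use 2 finite_proper_colorings[OF fin] in \<open>auto intro: finite_subset\<close>)
  then show "poly (chromatic_poly V E - chromatic_poly (V - {w}) ?C) (of_nat q)
      = of_nat (card (proper_colorings V (insert {v, w} E) q))"
    by (simp add: poly_chromatic_poly_of_nat[OF G q] poly_chromatic_poly_of_nat[OF G' q])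
qed

section \<open>The normalized chromatic polynomial\<close>

definition nchi :: "complex \<Rightarrow> 'a set \<Rightarrow> 'a set set \<Rightarrow> complex" where
  "nchi z V E = poly (chromatic_poly V E) z / z ^ card V"

lemma nchi_empty: "nchi z {} {} = 1"
  by (simp add: nchi_def chromatic_poly_empty)

lemma nchi_isolated:
  assumes "simple_graph V E" "w \<notin> V" "z \<noteq> 0"
  shows "nchi z (insert w V) E = nchi z V E"
  using assms by (simp add: nchi_def chromatic_poly_isolated simple_graph_def)

text \<open>Contraction loses one vertex, so the normalization leaves a factor 1/z in front of the
  second term.\<close>

lemma nchi_insert_edge:
  assumes G: "simple_graph V E" and vw: "v \<in> V" "w \<in> V" "v \<noteq> w" "{v, w} \<notin> E" and z: "z \<noteq> 0"
  shows "nchi z V (insert {v, w} E)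
    = nchi z V E + (-1 / z) * nchi z (V - {w}) ({e \<in> E. w \<notin> e} \<union> star v (nbhd E w))"
proof -
  have "finite V" using G by (simp add: simple_graph_def)
  then have "card V = Suc (card (V - {w}))"
    using vw by (metis card_Suc_Diff1)
  then show ?thesis
    using z by (simp add: nchi_def chromatic_poly_insert_edge[OF G vw] field_simps)
qed

definition induced :: "'a set set \<Rightarrow> 'a set \<Rightarrow> 'a set set" where
  "induced E W = {e \<in> E. e \<subseteq> W}"

lemma card_nbhd:
  assumes "simple_graph V E"
  shows "card (nbhd E v) = vertex_degree E v"
proof -
  have "bij_betw (\<lambda>u. {v, u}) (nbhd E v) {e \<in> E. v \<in> e}"
  proof (rule bij_betw_imageI)
    show "inj_on (\<lambda>u. {v, u}) (nbhd E v)" by (auto simp: inj_on_def doubleton_eq_iff)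
    have "\<exists>u. e = {v, u}" if "e \<in> E" "v \<in> e" for e
    proof -
      have "card e = 2" using assms that by (auto simp: simple_graph_def)
      then obtain a b where "e = {a, b}" by (auto simp: card_2_iff)
      then show ?thesis using that by auto
    qed
    then show "(\<lambda>u. {v, u}) ` nbhd E v = {e \<in> E. v \<in> e}"
      by (fastforce simp: nbhd_def image_iff)
  qed
  then show ?thesis unfolding vertex_degree_def by (rule bij_betw_same_card)
qed

section \<open>Inductive estimates for an abstract majorant\<close>

text \<open>\<open>B n\<close> bounds \<open>\<bar>Q - 1\<bar>\<close> for a star of \<open>n\<close> new edges, and \<open>B n - y n\<close> bounds
  \<open>\<bar>Q - 1 - x n\<bar>\<close>; \<open>\<epsilon>\<close> bounds the deviation of \<open>R\<close> from its linear part, and \<open>L\<close> bounds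
  \<open>\<bar>R\<bar>\<close> from below.\<close>

locale chromatic_majorant =
  fixes V :: "'a set" and E :: "'a set set" and z :: complex
    and d :: nat and y :: real and B :: "nat \<Rightarrow> real" and \<epsilon> :: real and L :: real
  assumes graph: "simple_graph V E"
    and degree: "v \<in> V \<Longrightarrow> card (nbhd E v) \<le> d"
    and z_nz: "z \<noteq> 0"
    and norm_z: "norm (1 / z) \<le> y"
    and B_0: "B 0 = 0"
    and B_Suc: "B n + y \<le> B (Suc n)"
    and eps: "\<epsilon> = (\<Sum>j<d. y * B j)"
    and L: "L = 1 - y * d - \<epsilon>" "L > 0"
    and majorant: "y * (B (n + d) + \<epsilon>) \<le> L * (B (Suc n) - B n - y)"
begin

definition x :: complex where "x = - 1 / z"

definition h :: "'a set \<Rightarrow> complex" where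
  "h W = nchi z W (induced E W)"

definition hs :: "'a set \<Rightarrow> 'a \<Rightarrow> 'a set \<Rightarrow> complex" where
  "hs W v S = nchi z W (induced E W \<union> star v S)"

text \<open>The vertex \<open>w\<close>, taken outside \<open>W\<close>, gets only the neighbors
  \<open>T\<close>; as \<open>T\<close> grows this interpolates between \<open>h W\<close> and
  \<open>h (insert w W)\<close>, which gives the ratio R.\<close>

definition hj :: "'a set \<Rightarrow> 'a \<Rightarrow> 'a set \<Rightarrow> complex" where
  "hj W w T = nchi z (insert w W) (induced E W \<union> star w T)"

lemma norm_x: "norm x \<le> y"
  using norm_z by (simp add: x_def norm_divide)

lemma y_nonneg: "y \<ge> 0"
  using norm_x norm_ge_zero[of x] by linarith

lemma finite_V: "finite V"
  using graph by (simp add: simple_graph_def)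

lemma simple_graph_induced: "W \<subseteq> V \<Longrightarrow> simple_graph W (induced E W)"
  using graph by (auto simp: simple_graph_def induced_def intro: finite_subset)

lemma nbhd_sym: "u \<in> nbhd E v \<longleftrightarrow> v \<in> nbhd E u"
  by (simp add: nbhd_def insert_commute)

lemma nbhd_irrefl: "u \<in> nbhd E v \<Longrightarrow> u \<noteq> v"
  using simple_graph_edgeD(3)[OF graph, of v u] by (auto simp: nbhd_def)

lemma nbhd_subset: "nbhd E v \<subseteq> V"
  using simple_graph_edgeD[OF graph] by (auto simp: nbhd_def)

lemma hs_empty: "hs W v {} = h W"
  by (simp add: hs_def h_def)

lemma hs_insert_nbhd:
  assumes "v \<in> W" "w \<in> W" "w \<in> nbhd E v"
  shows "hs W v (insert w S) = hs W v S"
proof -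
  have "{v, w} \<in> induced E W" using assms by (auto simp: nbhd_def induced_def)
  then show ?thesis by (simp add: hs_def insert_absorb)
qed

text \<open>The edge vw is new, and contracting it leaves \<open>v\<close> joined to
  \<open>S\<close> and to the former neighbors of \<open>w\<close>, all inside
  \<open>W - {w}\<close>.\<close>

lemma hs_insert:
  assumes W: "W \<subseteq> V" and vw: "v \<in> W" "w \<in> W" "v \<noteq> w" "w \<notin> nbhd E v"
    and S: "S \<subseteq> W - {v}" "w \<notin> S"
  shows "hs W v (insert w S) = hs W v S + x * hs (W - {w}) v (S \<union> (nbhd E w \<inter> W))"
proof -
  let ?F = "induced E W \<union> star v S"
  have F: "simple_graph W ?F"
    using simple_graph_Un_star[OF simple_graph_induced[OF W]] vw S by simp
  have 1: "{v, w} \<notin> ?F"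
    using vw S by (auto simp: nbhd_def induced_def star_def doubleton_eq_iff)
  have 2: "{e \<in> ?F. w \<notin> e} = induced E (W - {w}) \<union> star v S"
    using vw S by (auto simp: induced_def star_def)
  have 3: "nbhd ?F w = nbhd E w \<inter> W"
    using vw S by (auto simp: nbhd_def induced_def star_def doubleton_eq_iff)
  show ?thesis
    using nchi_insert_edge[OF F vw(1-3) 1 z_nz, unfolded 2 3]
    by (simp add: hs_def x_def star_Un Un_assoc)
qed

lemma hj_empty:
  assumes "W \<subseteq> V" "w \<notin> W"
  shows "hj W w {} = h W"
  using nchi_isolated[OF simple_graph_induced[OF assms(1)] assms(2) z_nz]
  by (simp add: hj_def h_def)

lemma hj_nbhd:
  assumes "w \<notin> W"
  shows "hj W w (nbhd E w \<inter> W) = h (insert w W)"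
proof -
  have "induced E (insert w W) = induced E W \<union> star w (nbhd E w \<inter> W)"
  proof (intro equalityI subsetI)
    fix e assume e: "e \<in> induced E (insert w W)"
    then have "card e = 2" using graph by (auto simp: induced_def simple_graph_def)
    then obtain a b where ab: "e = {a, b}" "a \<noteq> b" by (auto simp: card_2_iff)
    show "e \<in> induced E W \<union> star w (nbhd E w \<inter> W)"
      using e ab by (auto simp: induced_def star_def nbhd_def insert_commute)
  qed (auto simp: induced_def star_def nbhd_def)
  then show ?thesis by (simp add: hj_def h_def)
qed

text \<open>The edge uw is contracted onto \<open>u\<close>: the added vertex \<open>w\<close>
  disappears and its neighbors \<open>T\<close> become the leaves of a star at
  \<open>u\<close>.\<close>

lemma hj_insert:
  assumes W: "W \<subseteq> V" and w: "w \<in> V" "w \<notin> W" and u: "u \<in> W" "u \<notin> T" and T: "T \<subseteq> W"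
  shows "hj W w (insert u T) = hj W w T + x * hs W u T"
proof -
  let ?F = "induced E W \<union> star w T"
  have "simple_graph (insert w W) (induced E W)"
    using simple_graph_induced[OF W] by (auto simp: simple_graph_def)
  then have F: "simple_graph (insert w W) ?F"
    by (rule simple_graph_Un_star) (use w T in auto)
  have 1: "{u, w} \<notin> ?F"
    using w u by (auto simp: induced_def star_def doubleton_eq_iff)
  have 2: "{e \<in> ?F. w \<notin> e} = induced E W"
    using w by (auto simp: induced_def star_def)
  have 3: "nbhd ?F w = T"
    using w T by (auto simp: nbhd_def induced_def star_def doubleton_eq_iff)
  have 4: "insert w W - {w} = W" using w by auto
  show ?thesis
    using nchi_insert_edge[OF F _ _ _ 1 z_nz, unfolded 2 3 4] u w
    by (auto simp: hj_def hs_def x_def insert_commute)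
qed

lemma B_mono: "i \<le> j \<Longrightarrow> B i + y * (j - i) \<le> B j"
proof (induction j rule: dec_induct)
  case (step n)
  then show ?case using B_Suc[of n] by (simp add: algebra_simps)
qed simp

lemma B_le: "i \<le> j \<Longrightarrow> B i \<le> B j"
  using B_mono[of i j] mult_nonneg_nonneg[OF y_nonneg of_nat_0_le_iff[of "j - i"]] by linarith

lemma B_nonneg: "B j \<ge> 0"
  using B_le[of 0 j] B_0 by simp

lemma norm_x_of_nat: "norm (x * of_nat n) \<le> y * n"
  using mult_right_mono[OF norm_x, of "real n"] by (simp add: norm_mult)

text \<open>The induction hypothesis. The number b of new edges is
  \<open>card (S - nbhd E v)\<close>; leaves already adjacent to \<open>v\<close> are allowed
  because the contraction in the step can produce them.\<close>

definition good :: "'a set \<Rightarrow> bool" where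
  "good W \<longleftrightarrow> h W \<noteq> 0 \<and> (\<forall>v S. v \<in> W \<longrightarrow> S \<subseteq> W - {v} \<longrightarrow>
     norm (hs W v S / h W - 1 - x * of_nat (card (S - nbhd E v)))
       \<le> B (card (S - nbhd E v)) - y * card (S - nbhd E v))"

text \<open>The linear term costs at most y b and fills \<open>B b - y * b\<close> up to
  \<open>B b\<close>; monotonicity then passes from b to \<open>card S\<close>.\<close>

lemma good_norm_le:
  assumes W: "good W" "W \<subseteq> V" and v: "v \<in> W" "S \<subseteq> W - {v}"
  shows "norm (hs W v S / h W - 1) \<le> B (card S)"
proof -
  let ?b = "card (S - nbhd E v)"
  have "finite S" using W v finite_V by (meson finite_Diff finite_subset)
  then have "B ?b \<le> B (card S)" by (intro B_le card_mono) auto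
  moreover have "norm (hs W v S / h W - 1 - x * of_nat ?b) \<le> B ?b - y * ?b"
    using W v by (auto simp: good_def)
  moreover have "norm (hs W v S / h W - 1)
      \<le> norm (hs W v S / h W - 1 - x * of_nat ?b) + norm (x * of_nat ?b)"
    by (metis diff_add_cancel norm_triangle_ineq)
  ultimately show ?thesis using norm_x_of_nat[of ?b] by linarith
qed

text \<open>The edges at \<open>w\<close> are added one at a time; the one added after j others
  contributes x times the effect of a star with j leaves in \<open>W\<close>, which differs from 1
  by at most \<open>B j\<close>.\<close>

lemma hj_bound:
  assumes W: "good W" "W \<subseteq> V" and w: "w \<in> V" "w \<notin> W" and T: "T \<subseteq> W"
  shows "norm (hj W w T / h W - 1 - x * of_nat (card T)) \<le> (\<Sum>j<card T. y * B j)"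
proof -
  have "finite T" using W T finite_V by (meson finite_subset)
  then show ?thesis using T
  proof (induction T rule: finite_induct)
    case empty
    have "h W \<noteq> 0" using W by (simp add: good_def)
    then show ?case using hj_empty[OF W(2) w(2)] by simp
  next
    case (insert u T)
    have u: "u \<in> W" "T \<subseteq> W - {u}" using insert by auto
    have h: "h W \<noteq> 0" using W by (simp add: good_def)
    have "hj W w (insert u T) / h W - 1 - x * of_nat (card (insert u T))
        = (hj W w T / h W - 1 - x * of_nat (card T)) + x * (hs W u T / h W - 1)"
      using insert hj_insert[OF W(2) w u(1), of T] h by (simp add: field_simps)
    also have "norm \<dots> \<le> (\<Sum>j<card T. y * B j) + y * B (card T)"
      using insert.IH insert.prems
      by (intro norm_triangle_mono)
        (auto simp: norm_mult intro!: mult_mono norm_x y_nonneg good_norm_le[OF W u])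
    finally show ?case using insert by simp
  qed
qed

text \<open>This is \<open>hj_bound\<close> with the at most \<open>d\<close> neighbors of
  \<open>w\<close> in \<open>W\<close> as \<open>T\<close>. The triangle inequality then keeps the
  ratio away from 0, which carries \<open>h W \<noteq> 0\<close> through the induction.\<close>

lemma vertex_ratio:
  assumes W: "good W" "W \<subseteq> V" and w: "w \<in> V" "w \<notin> W"
  shows "norm (h (insert w W) / h W - 1 - x * of_nat (card (nbhd E w \<inter> W))) \<le> \<epsilon>"
    and "norm (h (insert w W) / h W) \<ge> L"
    and "h (insert w W) \<noteq> 0"
proof -
  let ?\<delta> = "card (nbhd E w \<inter> W)"
  have "?\<delta> \<le> card (nbhd E w)"
    using finite_subset[OF nbhd_subset finite_V] by (intro card_mono) auto
  with degree[OF w(1)] have \<delta>: "?\<delta> \<le> d" by simp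
  have "norm (h (insert w W) / h W - 1 - x * of_nat ?\<delta>) \<le> (\<Sum>j<?\<delta>. y * B j)"
    using hj_bound[OF W w, of "nbhd E w \<inter> W"] hj_nbhd[OF w(2)] by simp
  also have "\<dots> \<le> \<epsilon>"
    unfolding eps using \<delta> y_nonneg B_nonneg by (intro sum_mono2) auto
  finally show 1: "norm (h (insert w W) / h W - 1 - x * of_nat ?\<delta>) \<le> \<epsilon>" .
  have "y * ?\<delta> \<le> y * d" using \<delta> y_nonneg by (intro mult_left_mono) auto
  moreover have "norm (1::complex) \<le> norm (h (insert w W) / h W)
      + norm (h (insert w W) / h W - 1 - x * of_nat ?\<delta>) + norm (x * of_nat ?\<delta>)"
    using norm_triangle_ineq4[of "h (insert w W) / h W - x * of_nat ?\<delta>"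
        "h (insert w W) / h W - 1 - x * of_nat ?\<delta>"]
      norm_triangle_ineq4[of "h (insert w W) / h W" "x * of_nat ?\<delta>"]
    by simp
  ultimately show 2: "norm (h (insert w W) / h W) \<ge> L"
    using 1 norm_x_of_nat[of ?\<delta>] L by simp
  then show "h (insert w W) \<noteq> 0" using L by auto
qed

text \<open>An inner induction adds the leaves of \<open>S\<close> one by one. For each new leaf
  \<open>w\<close> the hypothesis on \<open>W - {w}\<close> is used twice: for the larger star
  (\<open>K\<close>) and for the vertex ratio (\<open>R\<close>).\<close>

lemma good_step:
  assumes W: "W \<subseteq> V" "W \<noteq> {}" and IH: "\<And>w. w \<in> W \<Longrightarrow> good (W - {w})"
  shows "good W"
  unfolding good_def
proof (intro conjI allI impI)
  have fin: "finite W" using W(1) finite_V by (rule finite_subset)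
  obtain w where w: "w \<in> W" using W by auto
  then show h: "h W \<noteq> 0"
    using vertex_ratio(3)[OF IH[OF w], of w] W by (auto simp: insert_absorb)
  fix v S assume v: "v \<in> W" and S: "S \<subseteq> W - {v}"
  have "finite S" using S fin by (meson finite_Diff finite_subset)
  then show "norm (hs W v S / h W - 1 - x * of_nat (card (S - nbhd E v)))
       \<le> B (card (S - nbhd E v)) - y * card (S - nbhd E v)"
    using S
  proof (induction S rule: finite_induct)
    case empty
    then show ?case using h by (simp add: hs_empty B_0)
  next
    case (insert w S)
    have w: "w \<in> W" "w \<noteq> v" and S: "S \<subseteq> W - {v}" using insert.prems by auto
    define b where "b = card (S - nbhd E v)"
    have IHS: "norm (hs W v S / h W - 1 - x * of_nat b) \<le> B b - y * b"
      using insert.IH S by (simp add: b_def)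
    show ?case
    proof (cases "w \<in> nbhd E v")
      case True
      then have "insert w S - nbhd E v = S - nbhd E v" by auto
      then show ?thesis
        using True IHS hs_insert_nbhd[OF v w(1)] by (simp add: b_def)
    next
      case False
      define W' where "W' = W - {w}"
      define N where "N = nbhd E w \<inter> W"
      define b' where "b' = card ((S \<union> N) - nbhd E v)"
      define K where "K = hs W' v (S \<union> N) / h W'"
      define R where "R = h W / h W'"
      have W': "good W'" "W' \<subseteq> V" "v \<in> W'" "w \<notin> W'" "w \<in> V" "insert w W' = W"
        using IH W w v by (auto simp: W'_def)
      have NW': "nbhd E w \<inter> W' = N" using nbhd_irrefl by (auto simp: N_def W'_def)
      have "v \<notin> N" using False nbhd_sym by (auto simp: N_def)
      then have SN: "S \<union> N \<subseteq> W' - {v}"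
        using S insert.hyps NW' by (auto simp: W'_def)
      have R1: "norm (R - 1 - x * of_nat (card N)) \<le> \<epsilon>" and R2: "norm R \<ge> L"
        using vertex_ratio[OF W'(1,2,5,4)] by (simp_all add: W' NW' R_def)
      have K: "norm (K - 1 - x * of_nat b') \<le> B b' - y * b'"
        using W' SN by (auto simp: good_def K_def b'_def)
      have cN: "card N \<le> d"
      proof -
        have "card N \<le> card (nbhd E w)"
          using finite_subset[OF nbhd_subset finite_V] by (intro card_mono) (auto simp: N_def)
        with degree[OF W'(5)] show ?thesis by simp
      qed
      have "b' \<le> card ((S - nbhd E v) \<union> N)"
        unfolding b'_def using insert.hyps fin by (intro card_mono) (auto simp: N_def)
      also have "\<dots> \<le> b + card N" unfolding b_def by (rule card_Un_le)
      finally have b': "b' \<le> b + card N" .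
      \<comment> \<open>Here the linear terms of \<open>K\<close> and \<open>R\<close> cancel in
        part: \<open>b' - card N\<close> lies between -d and b. The bound b + d is chosen to cancel
        against \<open>y * (b + d)\<close> below.\<close>
      have diff: "norm (x * (of_nat b' - of_nat (card N))) \<le> y * (b + d)"
      proof -
        have "norm (of_nat b' - of_nat (card N) :: complex) = \<bar>real b' - real (card N)\<bar>"
          by (metis norm_of_real of_real_diff of_real_of_nat_eq)
        also have "\<dots> \<le> real b + real d" using b' cN by linarith
        finally show ?thesis
          unfolding norm_mult by (intro mult_mono norm_x y_nonneg) auto
      qed
      have "K - R = (K - 1 - x * of_nat b') - (R - 1 - x * of_nat (card N))
          + x * (of_nat b' - of_nat (card N))"
        by (simp add: algebra_simps)
      then have "norm (K - R) \<le> norm (K - 1 - x * of_nat b')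
          + norm (R - 1 - x * of_nat (card N)) + norm (x * (of_nat b' - of_nat (card N)))"
        by (smt (verit) norm_triangle_ineq norm_triangle_ineq4)
      also have "\<dots> \<le> (B b' - y * b') + \<epsilon> + y * (b + d)"
        using K R1 diff by linarith
      \<comment> \<open>\<open>B n - y * n\<close> is nondecreasing in n, and b' is at most b +
        d.\<close>
      also have "B b' - y * b' \<le> B (b + d) - y * (b + d)"
        using B_mono[of b' "b + d"] b' cN by (simp add: of_nat_diff algebra_simps)
      finally have KR: "norm (K - R) \<le> B (b + d) + \<epsilon>" by simp
      have R0: "R \<noteq> 0" using R2 L by auto
      \<comment> \<open>The new edge adds \<open>x * (K / R)\<close>. Without its linear part x,
        this must fit into the increment of \<open>B n - y * n\<close> from b to b + 1, which is
        what \<open>majorant\<close> provides.\<close>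
      have "L * norm (x * (K / R - 1)) \<le> norm R * norm (x * (K / R - 1))"
        using R2 by (intro mult_right_mono) auto
      also have "\<dots> = norm x * norm (K - R)"
        using R0 by (simp add: norm_mult[symmetric] algebra_simps diff_divide_distrib)
      also have "\<dots> \<le> y * (B (b + d) + \<epsilon>)"
        using norm_x KR y_nonneg by (intro mult_mono) auto
      also have "\<dots> \<le> L * (B (Suc b) - B b - y)" by (rule majorant)
      finally have step: "norm (x * (K / R - 1)) \<le> B (Suc b) - B b - y"
        using L by simp
      have hW': "h W' \<noteq> 0" using W' by (simp add: good_def)
      have KR': "hs W' v (S \<union> N) / h W = K / R"
        using hW' h by (simp add: K_def R_def)
      have "hs W v (insert w S) / h W = hs W v S / h W + x * (K / R)"
        using hs_insert[OF W(1) v w(1) w(2)[symmetric] False S insert.hyps(2)]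
        by (simp add: W'_def[symmetric] N_def[symmetric] KR'[symmetric] add_divide_distrib)
      then have eq: "hs W v (insert w S) / h W - 1 - x * of_nat (Suc b)
          = (hs W v S / h W - 1 - x * of_nat b) + x * (K / R - 1)"
        by (simp add: algebra_simps)
      have "norm (hs W v (insert w S) / h W - 1 - x * of_nat (Suc b))
          \<le> (B b - y * b) + (B (Suc b) - B b - y)"
        unfolding eq by (rule norm_triangle_mono[OF IHS step])
      also have "\<dots> = B (Suc b) - y * Suc b" by (simp add: algebra_simps)
      finally have "norm (hs W v (insert w S) / h W - 1 - x * of_nat (Suc b))
          \<le> B (Suc b) - y * Suc b" .
      moreover have "card (insert w S - nbhd E v) = Suc b"
        using False insert.hyps by (simp add: b_def insert_Diff_if)
      ultimately show ?thesis by simp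
    qed
  qed
qed

lemma all_good:
  assumes "W \<subseteq> V"
  shows "good W"
proof -
  have "finite W" using assms finite_V by (rule finite_subset)
  then show ?thesis using assms
  proof (induction W rule: finite_psubset_induct)
    case (psubset W)
    show ?case
    proof (cases "W = {}")
      case True
      have "induced E {} = {}" using graph by (auto simp: induced_def simple_graph_def)
      then show ?thesis using True by (simp add: good_def h_def nchi_empty)
    next
      case False
      show ?thesis
        by (rule good_step[OF psubset.prems False]) (use psubset in auto)
    qed
  qed
qed

lemma poly_chromatic_poly_nonzero: "poly (chromatic_poly V E) z \<noteq> 0"
proof -
  have "induced E V = E" using graph by (auto simp: induced_def simple_graph_def)
  then show ?thesis using all_good[of V] by (auto simp: good_def h_def nchi_def)
qed

end

section \<open>An exponential majorant and the constant 4.25\<close>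

text \<open>For \<open>B n = A (\<mu>\<^sup>n - 1)\<close> the choice \<open>A = 1 - y d\<close>, here \<open>13/17\<close>, reduces the majorant
  condition to \<open>y \<mu>\<^sup>d \<le> L (\<mu> - 1)\<close>, independently of \<open>n\<close>. With \<open>\<mu> = 1 + 4/(5d)\<close> this is
  \<open>\<mu>\<^sup>d \<le> 338/150\<close>, which holds because \<open>exp (4/5) < 2.226\<close>.\<close>

lemma one_plus_power_le:
  assumes "d > 0"
  shows "(1 + 4 / (5 * real d)) ^ d \<le> 338 / 150"
proof -
  have "(1 + 4 / (5 * real d)) ^ d \<le> exp (4 / (5 * real d)) ^ d"
    by (intro power_mono exp_ge_add_one_self) auto
  also have "\<dots> = exp (4 / 5)"
    using assms by (simp add: exp_of_nat_mult[symmetric])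
  \<comment> \<open>The linear bound for exp is sharp only near 0, so 4/5 is cut into 32 pieces;
    (40/39)^32 is about 2.248, still below 338/150.\<close>
  also have "\<dots> = exp (1 / 40) ^ 32"
    by (simp add: exp_of_nat_mult[symmetric])
  also have "exp (1 / 40) \<le> (40 / 39 :: real)"
  proof -
    have "39 / 40 \<le> exp (- (1 / 40 :: real))"
      using exp_ge_add_one_self[of "- (1 / 40 :: real)"] by simp
    then show ?thesis by (simp add: exp_minus field_simps)
  qed
  then have "exp (1 / 40) ^ 32 \<le> (40 / 39 :: real) ^ 32"
    by (intro power_mono) auto
  also have "\<dots> \<le> 338 / 150" by (simp add: power_divide)
  finally show ?thesis .
qed

lemma chromatic_majorant_exponential:
  fixes V :: "'a set"
  assumes G: "simple_graph V E" and deg: "\<And>v. v \<in> V \<Longrightarrow> card (nbhd E v) \<le> d"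
    and d: "d > 0" and z: "z \<noteq> 0" "norm z \<ge> 4.25 * d"
  defines "y \<equiv> 4 / (17 * real d)" and "\<mu> \<equiv> 1 + 4 / (5 * real d)"
  defines "B \<equiv> \<lambda>n. 13 / 17 * (\<mu> ^ n - 1)"
  defines "\<epsilon> \<equiv> \<Sum>j<d. y * B j"
  shows "chromatic_majorant V E z d y B \<epsilon> (1 - y * d - \<epsilon>)"
proof -
  define L where "L = 1 - y * d - \<epsilon>"
  have \<mu>: "\<mu> > 1" using d by (simp add: \<mu>_def)
  have yd: "y * d = 4 / 17" using d by (simp add: y_def)
  have y\<mu>: "y = 5 / 17 * (\<mu> - 1)" by (simp add: y_def \<mu>_def)
  have m: "\<mu> ^ d \<le> 338 / 150" unfolding \<mu>_def by (rule one_plus_power_le[OF d])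
  have "\<epsilon> = (\<Sum>j<d. 13 / 17 * y * \<mu> ^ j - 13 / 17 * y)"
    unfolding \<epsilon>_def B_def by (intro sum.cong) (auto simp: field_simps)
  also have "\<dots> = 13 / 17 * (y * (\<Sum>j<d. \<mu> ^ j) - y * d)"
    unfolding sum_subtractf sum_distrib_left[symmetric] by (simp add: field_simps)
  also have "y * (\<Sum>j<d. \<mu> ^ j) = 5 / 17 * (\<mu> ^ d - 1)"
    using \<mu> by (simp add: y\<mu> power_diff_1_eq)
  finally have e: "\<epsilon> = 13 / 17 * (5 / 17 * (\<mu> ^ d - 1) - 4 / 17)" by (simp add: yd)
  \<comment> \<open>Writing m for \<open>\<mu> ^ d\<close>, 289 L = 338 - 65 m, so the claim is 150
    m \<le> 338.\<close>
  have key: "5 / 17 * \<mu> ^ d \<le> L" using m unfolding L_def e yd by (simp add: field_simps)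
  have pos: "\<mu> ^ n > 0" for n using \<mu> by simp
  have BS: "B (Suc n) - B n = 13 / 17 * \<mu> ^ n * (\<mu> - 1)" for n
    by (simp add: B_def field_simps)
  have "y * (B (n + d) + \<epsilon>) \<le> L * (B (Suc n) - B n - y)" for n
  proof -
    have "13 / 17 * \<mu> ^ n * (\<mu> - 1) * (5 / 17 * \<mu> ^ d) \<le> 13 / 17 * \<mu> ^ n * (\<mu> - 1) * L"
      using key \<mu> pos[of n] by (intro mult_left_mono) auto
    moreover have "y * (B (n + d) + \<epsilon>)
        = 13 / 17 * \<mu> ^ n * (\<mu> - 1) * (5 / 17 * \<mu> ^ d) - y * L"
    proof -
      \<comment> \<open>The constants combine to -L because 13/17 = 1 - y d; hence -y L occurs on
        both sides of the majorant condition.\<close>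
      have "B (n + d) + \<epsilon> = 13 / 17 * \<mu> ^ n * \<mu> ^ d - L"
        by (simp add: B_def L_def yd power_add right_diff_distrib)
      moreover have "y * (13 / 17 * \<mu> ^ n * \<mu> ^ d) = 13 / 17 * \<mu> ^ n * (\<mu> - 1) * (5 / 17 * \<mu> ^ d)"
        unfolding y\<mu> by (simp only: mult_ac)
      ultimately show ?thesis by (simp only: right_diff_distrib)
    qed
    moreover have "L * (B (Suc n) - B n - y) = 13 / 17 * \<mu> ^ n * (\<mu> - 1) * L - y * L"
      unfolding BS by (simp only: right_diff_distrib[of L] mult_ac)
    ultimately show ?thesis by linarith
  qed
  moreover have "B n + y \<le> B (Suc n)" for n
  proof -
    have "\<mu> ^ n \<ge> 1" using \<mu> by simp
    then have "1 * (\<mu> - 1) \<le> \<mu> ^ n * (\<mu> - 1)"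
      using \<mu> by (intro mult_right_mono) auto
    then show ?thesis using \<mu> y\<mu> BS[of n] by argo
  qed
  moreover have "norm (1 / z) \<le> y"
    using z d by (simp add: y_def norm_divide field_simps)
  moreover have "L > 0" using key pos[of d] by linarith
  ultimately show ?thesis
    using G deg z by unfold_locales (auto simp: B_def \<epsilon>_def L_def)
qed

theorem theorem1p1:
  fixes V :: "'a set" and E :: "'a set set" and z :: complex
  assumes "simple_graph V E"
    and "poly (chromatic_poly V E) z = 0"
  shows "norm z \<le> 4.25 * real (max_degree V E)"
proof (rule ccontr)
  assume neg: "\<not> norm z \<le> 4.25 * real (max_degree V E)"
  then have z: "z \<noteq> 0" by auto
  have fin: "finite V" using assms by (simp add: simple_graph_def)
  have deg: "card (nbhd E v) \<le> max_degree V E" if "v \<in> V" for v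
    using that fin card_nbhd[OF assms(1), of v] by (auto simp: max_degree_def)
  show False
  proof (cases "max_degree V E = 0")
    case False
    then have "0 < max_degree V E" "4.25 * real (max_degree V E) \<le> norm z"
      using neg by auto
    from chromatic_majorant.poly_chromatic_poly_nonzero
        [OF chromatic_majorant_exponential[OF assms(1) deg this(1) z this(2)]]
    show False using assms(2) by simp
  next
    case True
    let ?y = "norm (1 / z)"
    have "?y * 1 \<le> ?y * (1 + ?y) ^ n" for n
      by (intro mult_left_mono one_le_power) auto
    then interpret chromatic_majorant V E z 0 ?y "\<lambda>n. (1 + ?y) ^ n - 1" 0 1
      using assms(1) deg True z by unfold_locales (auto simp: algebra_simps)
    show False using poly_chromatic_poly_nonzero assms(2) by simp
  qed
qed

end
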